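(* Let $U=U_1\times\cdots\times U_m$ be a Cartesian product of nonempty finite sets. If $G=(V,E)$ is a quasi-median graph isometrically embedded into the Hamming graph $H(U)$, then $V$ (identified with its image in $U$) is an ample subset of $U$.
   Context: Graphs are finite, simple and connected; $d$ is the graph distance and $[u,v]=\{x: d(u,x)+d(x,v)=d(u,v)\}$. A set of vertices is convex if it contains $[u,v]$ for all its $u,v$. Three vertices $v_1,v_2,v_3$ form a metric triangle $v_1v_2v_3$ if $[v_i,v_j]\cap[v_i,v_k]=\{v_i\}$ for $\{i,j,k\}=\{1,2,3\}$; it is equilateral if $d(v_1,v_2)=d(v_2,v_3)=d(v_3,v_1)$. A quasi-median of a triplet $u_1,u_2,u_3$ is a metric triangle $v_1v_2v_3$ with $d(u_i,u_j)=d(u_i,v_i)+d(v_i,v_j)+d(v_j,u_j)$ for all $i\neq j$. A graph $G$ is quasi-median if: each triplet of vertices has a unique quasi-median and it is an equilateral metric triangle; $G$ contains no induced kite $K_4^-$ (two triangles glued along an edge); and the convex hull of any isometric 6-cycle is a 3-cube. The Hamming graph $H(U)$ has vertex set $U$, two tuples being adjacent iff they differ in exactly one coordinate. An isometric embedding is a distance-preserving map of vertex sets. A generalized partition of $U$ is a tuple $\Lambda=(\alpha_1,\dots,\alpha_m)$ with $\alpha_i$ a partition of $U_i$ into nonempty blocks; it defines a partition of $U$ into the boxes $P^1\times\cdots\times P^m$, $P^i\in\alpha_i$, and the minor-subproduct $M(\Lambda)=M_1\times\cdots\times M_m$, where $M_i$ is the set of blocks of $\alpha_i$. $M(\Lambda)$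 is shattered by $S\subseteq U$ if $S$ meets every box of the box-partition. A copy of $M(\Lambda)$ is a set $W_1\times\cdots\times W_m$ where $W_i$ consists of exactly one element from each block of $\alpha_i$. $M(\Lambda)$ is strongly shattered by $S$ if $S$ contains a copy of it. $S$ is ample if every minor-subproduct of $U$ shattered by $S$ is strongly shattered by $S$. *)

theory Defs
  imports "Graph_Theory.Graph_Theory" "HOL-Library.FuncSet" "HOL-Library.Disjoint_Sets"
begin

section \<open>Graph distance and convexity\<close>

text \<open>
  A finite simple graph is a \<^locale>\<open>pair_graph\<close>: a finite, loop-free digraph whose arc
  set is symmetric, each edge being represented by its two orientations.

  The distance is only meaningful for vertices joined by a walk (the infimum of the
  empty set is 0).
\<close>

definition gdist :: "'v pair_pre_digraph \<Rightarrow> 'v \<Rightarrow> 'v \<Rightarrow> nat" where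
  "gdist G u v = Inf (length ` {p. pre_digraph.awalk (with_proj G) u p v})"

definition interval :: "'v pair_pre_digraph \<Rightarrow> 'v \<Rightarrow> 'v \<Rightarrow> 'v set" where
  "interval G u v = {x \<in> pverts G. gdist G u x + gdist G x v = gdist G u v}"

definition geodesically_convex :: "'v pair_pre_digraph \<Rightarrow> 'v set \<Rightarrow> bool" where
  "geodesically_convex G S \<longleftrightarrow>
     S \<subseteq> pverts G \<and> (\<forall>u\<in>S. \<forall>v\<in>S. interval G u v \<subseteq> S)"

definition isometric_embedding ::
    "('v \<Rightarrow> 'w) \<Rightarrow> 'v pair_pre_digraph \<Rightarrow> 'w pair_pre_digraph \<Rightarrow> bool" where
  "isometric_embedding f G H \<longleftrightarrow>
     f ` pverts G \<subseteq> pverts H \<and>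
     (\<forall>u\<in>pverts G. \<forall>v\<in>pverts G. gdist H (f u) (f v) = gdist G u v)"

section \<open>Hamming graphs and cycles\<close>

text \<open>
  The product of the sets \<open>U 1, \<dots>, U m\<close> is the extensional product
  \<^term>\<open>Pi\<^sub>E {1..m} U\<close>; all factors live in one ambient type.
\<close>

definition hamming_graph :: "nat \<Rightarrow> (nat \<Rightarrow> 'a set) \<Rightarrow> (nat \<Rightarrow> 'a) pair_pre_digraph" where
  "hamming_graph m U =
     \<lparr> pverts = Pi\<^sub>E {1..m} U,
       parcs = {(x, y). x \<in> Pi\<^sub>E {1..m} U \<and> y \<in> Pi\<^sub>E {1..m} U \<and>
                        (\<exists>!i. i \<in> {1..m} \<and> x i \<noteq> y i)} \<rparr>"

definition cube_graph :: "nat \<Rightarrow> (nat \<Rightarrow> bool) pair_pre_digraph" where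
  "cube_graph n = hamming_graph n (\<lambda>_. UNIV)"

text \<open>Intended for \<open>n \<ge> 3\<close>.\<close>

definition cycle_graph :: "nat \<Rightarrow> nat pair_pre_digraph" where
  "cycle_graph n =
     \<lparr> pverts = {..<n},
       parcs = {(i, j). i < n \<and> j < n \<and> (j = Suc i mod n \<or> i = Suc j mod n)} \<rparr>"

section \<open>Quasi-median graphs\<close>

text \<open>Degenerate metric triangles, with all three vertices equal, are allowed.\<close>

definition metric_triangle :: "'v pair_pre_digraph \<Rightarrow> 'v \<Rightarrow> 'v \<Rightarrow> 'v \<Rightarrow> bool" where
  "metric_triangle G v1 v2 v3 \<longleftrightarrow>
     v1 \<in> pverts G \<and> v2 \<in> pverts G \<and> v3 \<in> pverts G \<and>
     interval G v1 v2 \<inter> interval G v1 v3 = {v1} \<and>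
     interval G v2 v1 \<inter> interval G v2 v3 = {v2} \<and>
     interval G v3 v1 \<inter> interval G v3 v2 = {v3}"

definition equilateral :: "'v pair_pre_digraph \<Rightarrow> 'v \<Rightarrow> 'v \<Rightarrow> 'v \<Rightarrow> bool" where
  "equilateral G v1 v2 v3 \<longleftrightarrow>
     gdist G v1 v2 = gdist G v2 v3 \<and> gdist G v2 v3 = gdist G v3 v1"

definition quasi_median ::
    "'v pair_pre_digraph \<Rightarrow> 'v \<times> 'v \<times> 'v \<Rightarrow> 'v \<times> 'v \<times> 'v \<Rightarrow> bool" where
  "quasi_median G = (\<lambda>(u1, u2, u3) (v1, v2, v3).
     metric_triangle G v1 v2 v3 \<and>
     gdist G u1 u2 = gdist G u1 v1 + gdist G v1 v2 + gdist G v2 u2 \<and>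
     gdist G u2 u3 = gdist G u2 v2 + gdist G v2 v3 + gdist G v3 u3 \<and>
     gdist G u3 u1 = gdist G u3 v3 + gdist G v3 v1 + gdist G v1 u1)"

definition has_induced_kite :: "'v pair_pre_digraph \<Rightarrow> bool" where
  "has_induced_kite G \<longleftrightarrow>
     (\<exists>a b c d. {(a, b), (b, c), (c, a), (b, d), (d, c)} \<subseteq> parcs G \<and>
                a \<noteq> d \<and> (a, d) \<notin> parcs G)"

text \<open>The vertex set of an isometric 6-cycle is the image of an isometric embedding of \<open>C\<^sub>6\<close>.\<close>

definition quasi_median_graph :: "'v pair_pre_digraph \<Rightarrow> bool" where
  "quasi_median_graph G \<longleftrightarrow>
     pair_graph G \<and> connected (with_proj G) \<and>
     (\<forall>u \<in> pverts G \<times> pverts G \<times> pverts G.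
        (\<exists>!v. quasi_median G u v) \<and>
        (\<forall>v1 v2 v3. quasi_median G u (v1, v2, v3) \<longrightarrow> equilateral G v1 v2 v3)) \<and>
     \<not> has_induced_kite G \<and>
     (\<forall>c. isometric_embedding c (cycle_graph 6) G \<longrightarrow>
        digraph_iso (with_proj G \<restriction> (geodesically_convex G hull (c ` pverts (cycle_graph 6))))
                    (with_proj (cube_graph 3)))"

section \<open>Ample sets\<close>

definition generalized_partition :: "nat \<Rightarrow> (nat \<Rightarrow> 'a set) \<Rightarrow> (nat \<Rightarrow> 'a set set) \<Rightarrow> bool" where
  "generalized_partition m U \<Lambda> \<longleftrightarrow> (\<forall>i\<in>{1..m}. partition_on (U i) (\<Lambda> i))"

text \<open>An element of the minor-subproduct is a tuple \<open>P\<close> of blocks; its box is \<^term>\<open>Pi\<^sub>E {1..m} P\<close>.\<close>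

definition minor_subproduct :: "nat \<Rightarrow> (nat \<Rightarrow> 'a set set) \<Rightarrow> (nat \<Rightarrow> 'a set) set" where
  "minor_subproduct m \<Lambda> = Pi\<^sub>E {1..m} \<Lambda>"

definition shattered :: "nat \<Rightarrow> (nat \<Rightarrow> 'a set set) \<Rightarrow> (nat \<Rightarrow> 'a) set \<Rightarrow> bool" where
  "shattered m \<Lambda> S \<longleftrightarrow> (\<forall>P \<in> minor_subproduct m \<Lambda>. S \<inter> Pi\<^sub>E {1..m} P \<noteq> {})"

definition is_copy ::
    "nat \<Rightarrow> (nat \<Rightarrow> 'a set) \<Rightarrow> (nat \<Rightarrow> 'a set set) \<Rightarrow> (nat \<Rightarrow> 'a) set \<Rightarrow> bool" where
  "is_copy m U \<Lambda> C \<longleftrightarrow>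
     (\<exists>W. C = Pi\<^sub>E {1..m} W \<and>
          (\<forall>i\<in>{1..m}. W i \<subseteq> U i \<and> (\<forall>B\<in>\<Lambda> i. \<exists>!x. x \<in> W i \<inter> B)))"

definition strongly_shattered ::
    "nat \<Rightarrow> (nat \<Rightarrow> 'a set) \<Rightarrow> (nat \<Rightarrow> 'a set set) \<Rightarrow> (nat \<Rightarrow> 'a) set \<Rightarrow> bool" where
  "strongly_shattered m U \<Lambda> S \<longleftrightarrow> (\<exists>C. is_copy m U \<Lambda> C \<and> C \<subseteq> S)"

definition ample :: "nat \<Rightarrow> (nat \<Rightarrow> 'a set) \<Rightarrow> (nat \<Rightarrow> 'a) set \<Rightarrow> bool" where
  "ample m U S \<longleftrightarrow>
     S \<subseteq> Pi\<^sub>E {1..m} U \<and>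
     (\<forall>\<Lambda>. generalized_partition m U \<Lambda> \<and> shattered m \<Lambda> S \<longrightarrow> strongly_shattered m U \<Lambda> S)"

end

(*
  For a set S of tuples, the proof uses three conditions, each derived from quasi-medians: any two
  tuples of S are joined inside S by a Hamming geodesic; if S contains an edge in direction i, then
  it contains the clique through this edge with all values that occur in S at coordinate i; and if
  x[i := y_i], x[j := y_j], x, y are in S, then so is x[i := y_i, j := y_j]. The last one is where
  isometric 6-cycles enter.

  If \<Lambda>_i has at least two blocks and S shatters M(\<Lambda>), then every box contains an edge in direction
  i, found on a geodesic between tuples whose i-th coordinates lie in different blocks. Hence the
  union of the full cliques in direction i still shatters M(\<Lambda>), and it inherits the three
  conditions. So a minimal subset of S with all these properties is a product in the
  directions i for which \<Lambda>_i is not trivial, and thus contains a copy of M(\<Lambda>).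
*)
theory Submission
  imports Defs
begin

section \<open>Closure conditions on sets of tuples, and their persistence under filling\<close>

section \<open>Fillings of a coordinate\<close>

text \<open>Only the first step of a geodesic is demanded. Iterating towards the same
  \<open>y\<close> gives all of it when \<open>x\<close> and \<open>y\<close> differ in finitely
  many coordinates.\<close>

definition geodesic_set :: "('i \<Rightarrow> 'a) set \<Rightarrow> bool" where
  "geodesic_set S \<longleftrightarrow> (\<forall>x\<in>S. \<forall>y\<in>S. x \<noteq> y \<longrightarrow> (\<exists>j. x j \<noteq> y j \<and> x(j := y j) \<in> S))"

definition clique_closed :: "('i \<Rightarrow> 'a) set \<Rightarrow> bool" where
  "clique_closed S \<longleftrightarrow>
     (\<forall>x\<in>S. \<forall>y\<in>S. \<forall>i b. b \<noteq> x i \<longrightarrow> x(i := b) \<in> S \<longrightarrow> x(i := y i) \<in> S)"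

definition square_closed :: "('i \<Rightarrow> 'a) set \<Rightarrow> bool" where
  "square_closed S \<longleftrightarrow>
     (\<forall>x\<in>S. \<forall>y\<in>S. \<forall>i j. x(i := y i) \<in> S \<longrightarrow> x(j := y j) \<in> S \<longrightarrow> x(i := y i, j := y j) \<in> S)"

lemma geodesic_setD:
  "geodesic_set S \<Longrightarrow> x \<in> S \<Longrightarrow> y \<in> S \<Longrightarrow> x \<noteq> y \<Longrightarrow> \<exists>j. x j \<noteq> y j \<and> x(j := y j) \<in> S"
  by (simp add: geodesic_set_def)

lemma clique_closedD:
  "clique_closed S \<Longrightarrow> x \<in> S \<Longrightarrow> y \<in> S \<Longrightarrow> x(i := b) \<in> S \<Longrightarrow> b \<noteq> x i \<Longrightarrow> x(i := y i) \<in> S"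
  by (simp add: clique_closed_def)

lemma square_closedD:
  "square_closed S \<Longrightarrow> x \<in> S \<Longrightarrow> y \<in> S \<Longrightarrow> x(i := y i) \<in> S \<Longrightarrow> x(j := y j) \<in> S
    \<Longrightarrow> x(i := y i, j := y j) \<in> S"
  by (simp add: square_closed_def)

text \<open>The union of those direction-\<open>i\<close> cliques in \<open>S\<close> that carry
  every value taken by \<open>S\<close> at \<open>i\<close>. The sets with
  \<open>fill i S = S\<close> are those that split off coordinate \<open>i\<close> as a
  factor.\<close>

definition fill :: "'i \<Rightarrow> ('i \<Rightarrow> 'a) set \<Rightarrow> ('i \<Rightarrow> 'a) set" where
  "fill i S = {x \<in> S. \<forall>y\<in>S. x(i := y i) \<in> S}"

lemma fill_memD: "x \<in> fill i S \<Longrightarrow> x \<in> S"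
  by (simp add: fill_def)

lemma fill_subset: "fill i S \<subseteq> S"
  by (auto simp: fill_def)

lemma fill_upd: "x \<in> fill i S \<Longrightarrow> y \<in> S \<Longrightarrow> x(i := y i) \<in> fill i S"
  by (auto simp: fill_def)

text \<open>The update at \<open>i\<close> comes first in the premise: a member \<open>x\<close> of
  the filling provides the tuples \<open>x(i := y i)\<close>, and the closure conditions of
  \<open>S\<close> are applied at these parallel copies.\<close>

lemma fill_updI:
  assumes "i \<noteq> j" "\<And>y. y \<in> S \<Longrightarrow> x(i := y i, j := b) \<in> S" "x(j := b) \<in> S"
  shows "x(j := b) \<in> fill i S"
  using assms by (auto simp: fill_def fun_upd_twist)

text \<open>A step at \<open>i\<close> never leaves the filling. A step at another coordinate exists
  in \<open>S\<close>, and squares carry it to every value at \<open>i\<close>.\<close>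

lemma geodesic_fill:
  assumes g: "geodesic_set S" and s: "square_closed S"
  shows "geodesic_set (fill i S)"
  unfolding geodesic_set_def
proof (intro ballI impI)
  fix x y assume x: "x \<in> fill i S" and y: "y \<in> fill i S" and ne: "x \<noteq> y"
  show "\<exists>j. x j \<noteq> y j \<and> x(j := y j) \<in> fill i S"
  proof (cases "x i = y i")
    case False
    have "x(i := y i) \<in> fill i S" by (rule fill_upd[OF x fill_memD[OF y]])
    with False show ?thesis by (intro exI[of _ i] conjI)
  next
    case True
    have xS: "x \<in> S" and yS: "y \<in> S" using x y by (auto dest: fill_memD)
    from geodesic_setD[OF g xS yS ne] obtain j where j: "x j \<noteq> y j" "x(j := y j) \<in> S" by blast
    with True have ij: "i \<noteq> j" by auto
    have "x(i := t i, j := y j) \<in> S" if t: "t \<in> S" for t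
    proof -
      \<comment> \<open>The square at \<open>x\<close> needs a target with \<open>t i\<close> at
        \<open>i\<close> and \<open>y j\<close> at \<open>j\<close>. This one is in \<open>S\<close>
        because \<open>y\<close> is in the filling.\<close>
      let ?y = "y(i := t i)"
      have "x(i := ?y i) \<in> S" "?y \<in> S" using x y t by (simp_all add: fill_def)
      moreover have "x(j := ?y j) \<in> S" using j ij by simp
      ultimately have "x(i := ?y i, j := ?y j) \<in> S"
        by (intro square_closedD[OF s xS])
      then show ?thesis using ij by simp
    qed
    then have "x(j := y j) \<in> fill i S" by (rule fill_updI[OF ij _ j(2)])
    with j(1) show ?thesis by (intro exI[of _ j] conjI)
  qed
qed

text \<open>Both ends of the given edge lie in the filling, so the edge has a parallel copy in
  \<open>S\<close> for each value at \<open>i\<close>; the condition for \<open>S\<close> applies to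
  each copy, always with the same \<open>y\<close>.\<close>

lemma clique_closed_fill:
  assumes c: "clique_closed S"
  shows "clique_closed (fill i S)"
  unfolding clique_closed_def
proof (intro ballI allI impI)
  fix x y j b
  assume x: "x \<in> fill i S" and y: "y \<in> fill i S" and b: "b \<noteq> x j" and xb: "x(j := b) \<in> fill i S"
  have yS: "y \<in> S" using y by (rule fill_memD)
  show "x(j := y j) \<in> fill i S"
  proof (cases "i = j")
    case True
    then show ?thesis using fill_upd[OF x yS] by simp
  next
    case False
    show ?thesis
    proof (rule fill_updI[OF False])
      fix t assume t: "t \<in> S"
      have "x(i := t i) \<in> S" "(x(i := t i))(j := b) \<in> S" "b \<noteq> (x(i := t i)) j"
        using x xb t b False by (auto simp: fill_def fun_upd_twist)
      then show "x(i := t i, j := y j) \<in> S"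
        by (rule clique_closedD[OF c _ yS])
    next
      show "x(j := y j) \<in> S"
        using clique_closedD[OF c fill_memD[OF x] yS fill_memD[OF xb] b] .
    qed
  qed
qed

text \<open>If \<open>j\<close> or \<open>k\<close> is \<open>i\<close>, the last update stays in
  the filling anyway. Otherwise the condition for \<open>S\<close> is used in every parallel copy;
  the same \<open>y\<close> serves all of them, as only \<open>y j\<close> and \<open>y k\<close>
  enter.\<close>

lemma square_closed_fill:
  assumes s: "square_closed S"
  shows "square_closed (fill i S)"
  unfolding square_closed_def
proof (intro ballI allI impI)
  fix x y j k
  assume x: "x \<in> fill i S" and y: "y \<in> fill i S"
    and xj: "x(j := y j) \<in> fill i S" and xk: "x(k := y k) \<in> fill i S"
  have yS: "y \<in> S" using y by (rule fill_memD)
  consider "k = i" | "k \<noteq> i" "j = i" | "k \<noteq> i" "j \<noteq> i" by blast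
  then show "x(j := y j, k := y k) \<in> fill i S"
  proof cases
    case 1
    then show ?thesis using fill_upd[OF xj yS] by simp
  next
    case 2
    then show ?thesis using fill_upd[OF xk yS] by (simp add: fun_upd_twist)
  next
    case 3
    have *: "x(j := y j, k := y k) \<in> S" if "x \<in> S" "x(j := y j) \<in> S" "x(k := y k) \<in> S" for x
      using square_closedD[OF s that(1) yS that(2,3)] .
    show ?thesis
    proof (rule fill_updI)
      fix t assume t: "t \<in> S"
      have "x(i := t i) \<in> S" "x(i := t i, j := y j) \<in> S" "x(i := t i, k := y k) \<in> S"
        using x xj xk t 3 by (auto simp: fill_def fun_upd_twist)
      then show "x(j := y j, i := t i, k := y k) \<in> S"
        using *[of "x(i := t i)"] 3 by (simp add: fun_upd_twist)
    next
      show "x(j := y j, k := y k) \<in> S"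
        using *[OF fill_memD[OF x] fill_memD[OF xj] fill_memD[OF xk]] .
    qed (use 3 in simp)
  qed
qed

text \<open>A geodesic from \<open>x\<close> to \<open>y\<close> must change coordinate
  \<open>i\<close> at some step. The last clause keeps the edge found there inside the box spanned
  by \<open>x\<close> and \<open>y\<close>.\<close>

lemma geodesic_set_edge:
  assumes g: "geodesic_set S" and "finite {j. x j \<noteq> y j}" "x \<in> S" "y \<in> S" "x i \<noteq> y i"
  shows "\<exists>z\<in>S. z i \<noteq> y i \<and> z(i := y i) \<in> S \<and> (\<forall>j. z j = x j \<or> z j = y j)"
  using assms(2-)
proof (induction "card {j. x j \<noteq> y j}" arbitrary: x rule: less_induct)
  case less
  have "x \<noteq> y" using less.prems by auto
  from geodesic_setD[OF g less.prems(2,3) this]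
  obtain j where j: "x j \<noteq> y j" "x(j := y j) \<in> S" by blast
  show ?case
  proof (cases "j = i")
    case True
    with j less.prems show ?thesis by blast
  next
    case False
    let ?x = "x(j := y j)"
    have "{l. ?x l \<noteq> y l} \<subset> {l. x l \<noteq> y l}" using j by auto
    from psubset_card_mono[OF less.prems(1) this] finite_subset[OF psubset_imp_subset[OF this] less.prems(1)]
    have "card {l. ?x l \<noteq> y l} < card {l. x l \<noteq> y l}" "finite {l. ?x l \<noteq> y l}" .
    moreover have "?x i \<noteq> y i" using False less.prems by simp
    ultimately obtain z where "z \<in> S" "z i \<noteq> y i" "z(i := y i) \<in> S" "\<forall>l. z l = ?x l \<or> z l = y l"
      using less.hyps[of ?x] j less.prems by blast
    then show ?thesis by (metis fun_upd_apply)
  qed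
qed

section \<open>Shattering: passing to fillings and extracting a copy\<close>

lemma generalized_partitionD:
  assumes "generalized_partition m U \<Lambda>" "i \<in> {1..m}"
  shows "\<Union> (\<Lambda> i) = U i" "\<And>B C. B \<in> \<Lambda> i \<Longrightarrow> C \<in> \<Lambda> i \<Longrightarrow> B \<noteq> C \<Longrightarrow> B \<inter> C = {}"
proof -
  have "partition_on (U i) (\<Lambda> i)"
    using assms by (simp only: generalized_partition_def)
  then show "\<Union> (\<Lambda> i) = U i" "\<And>B C. B \<in> \<Lambda> i \<Longrightarrow> C \<in> \<Lambda> i \<Longrightarrow> B \<noteq> C \<Longrightarrow> B \<inter> C = {}"
    by (auto simp: partition_on_def disjoint_def)
qed

lemma PiE_neq_mem: "x \<in> Pi\<^sub>E I A \<Longrightarrow> y \<in> Pi\<^sub>E I B \<Longrightarrow> x j \<noteq> y j \<Longrightarrow> j \<in> I"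
  by (metis PiE_arb)

lemma shatteredE:
  assumes "shattered m \<Lambda> S" "P \<in> minor_subproduct m \<Lambda>"
  obtains x where "x \<in> S" "x \<in> Pi\<^sub>E {1..m} P"
  using assms by (auto simp: shattered_def)

text \<open>A geodesic runs from a tuple of the box \<open>P\<close> to a tuple of the box that
  differs from \<open>P\<close> only in its block at \<open>i\<close>. Its edge in direction
  \<open>i\<close> extends to a full clique, which meets the box \<open>P\<close>.\<close>

lemma shattered_fill:
  assumes g: "geodesic_set S" and c: "clique_closed S" and SU: "S \<subseteq> Pi\<^sub>E {1..m} U"
    and part: "generalized_partition m U \<Lambda>" and sh: "shattered m \<Lambda> S"
    and i: "i \<in> {1..m}" and two: "B1 \<in> \<Lambda> i" "B2 \<in> \<Lambda> i" "B1 \<noteq> B2"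
  shows "shattered m \<Lambda> (fill i S)"
  unfolding shattered_def
proof
  fix P assume P: "P \<in> minor_subproduct m \<Lambda>"
  obtain B where B: "B \<in> \<Lambda> i" "B \<noteq> P i" using two by metis
  have "P(i := B) \<in> minor_subproduct m \<Lambda>"
    using P B i by (auto simp: minor_subproduct_def PiE_def Pi_def extensional_def)
  from shatteredE[OF sh this] obtain y where y: "y \<in> S" "y \<in> Pi\<^sub>E {1..m} (P(i := B))" .
  from shatteredE[OF sh P] obtain x where x: "x \<in> S" "x \<in> Pi\<^sub>E {1..m} P" .
  have "P i \<in> \<Lambda> i" using P i by (auto simp: minor_subproduct_def)
  then have "P i \<inter> B = {}"
    using generalized_partitionD(2)[OF part i] B by blast
  moreover have xi: "x i \<in> P i" and "y i \<in> B"
    using PiE_mem[OF x(2) i] PiE_mem[OF y(2) i] by simp_all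
  ultimately have ne: "x i \<noteq> y i" by auto
  have "{j. x j \<noteq> y j} \<subseteq> {1..m}"
    using PiE_neq_mem[OF x(2) y(2)] by blast
  then have "finite {j. x j \<noteq> y j}" using finite_subset by blast
  from geodesic_set_edge[OF g this x(1) y(1) ne]
  obtain z where z: "z \<in> S" "z i \<noteq> y i" "z(i := y i) \<in> S" and zxy: "\<And>j. z j = x j \<or> z j = y j"
    by blast
  have all: "z(i := t i) \<in> S" if "t \<in> S" for t
    using clique_closedD[OF c z(1) that z(3)] z(2) by simp
  \<comment> \<open>Away from \<open>i\<close>, each value of \<open>z\<close> comes from
    \<open>x\<close> or \<open>y\<close>, and both lie in the blocks of \<open>P\<close> there; at
    \<open>i\<close> the value \<open>x i\<close> lies in \<open>P i\<close>.\<close>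
  have "z(i := x i) \<in> fill i S" using all x(1) by (auto simp: fill_def)
  moreover have "(z(i := x i)) l \<in> P l" if l: "l \<in> {1..m}" for l
    using PiE_mem[OF x(2) l] PiE_mem[OF y(2) l] xi zxy[of l] by (auto split: if_splits)
  then have "z(i := x i) \<in> Pi\<^sub>E {1..m} P"
    using i z(1) SU by (auto simp: PiE_def extensional_def Pi_def)
  ultimately show "fill i S \<inter> Pi\<^sub>E {1..m} P \<noteq> {}" by blast
qed

lemma exists_partition_tuple:
  assumes "generalized_partition m U \<Lambda>" "\<And>i. i \<in> {1..m} \<Longrightarrow> U i \<noteq> {}"
  obtains P where "P \<in> minor_subproduct m \<Lambda>"
proof -
  have "\<forall>i\<in>{1..m}. \<Lambda> i \<noteq> {}"
    using generalized_partitionD(1)[OF assms(1)] assms(2) by fastforce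
  then have "minor_subproduct m \<Lambda> \<noteq> {}"
    by (simp add: minor_subproduct_def PiE_eq_empty_iff)
  with that show thesis by blast
qed

text \<open>The copy consists of one value per block, each read off from a tuple of
  \<open>S\<close>. Any combination of these values is reached from a fixed \<open>x\<close> by
  exchanging coordinates one at a time.\<close>

lemma strongly_shattered_if_closed:
  assumes SU: "S \<subseteq> Pi\<^sub>E {1..m} U" and part: "generalized_partition m U \<Lambda>"
    and ne: "\<And>i. i \<in> {1..m} \<Longrightarrow> U i \<noteq> {}" and sh: "shattered m \<Lambda> S"
    and closed: "\<And>i x y B1 B2. \<lbrakk>i \<in> {1..m}; B1 \<in> \<Lambda> i; B2 \<in> \<Lambda> i; B1 \<noteq> B2; x \<in> S; y \<in> S\<rbrakk>
      \<Longrightarrow> x(i := y i) \<in> S"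
  shows "strongly_shattered m U \<Lambda> S"
proof -
  obtain P where P: "P \<in> minor_subproduct m \<Lambda>"
    using exists_partition_tuple[OF part ne] .
  from shatteredE[OF sh this] obtain x where x: "x \<in> S" .
  define trivial where "trivial i \<longleftrightarrow> (\<forall>B1\<in>\<Lambda> i. \<forall>B2\<in>\<Lambda> i. B1 = B2)" for i
  have meet: "\<exists>y\<in>S. y i \<in> B" if i: "i \<in> {1..m}" and B: "B \<in> \<Lambda> i" for i B
  proof -
    have "P(i := B) \<in> minor_subproduct m \<Lambda>"
      using P B i by (auto simp: minor_subproduct_def PiE_def Pi_def extensional_def)
    from shatteredE[OF sh this] obtain y where "y \<in> S" "y \<in> Pi\<^sub>E {1..m} (P(i := B))" .
    then show ?thesis using PiE_mem[of y "{1..m}" "P(i := B)" i] i by auto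
  qed
  \<comment> \<open>On a trivial coordinate no exchange is available, so the representative is the value of the fixed \<open>x\<close>.\<close>
  define r where "r i B = (if trivial i then x else (SOME y. y \<in> S \<and> y i \<in> B))" for i B
  have r: "r i B \<in> S \<and> r i B i \<in> B" if i: "i \<in> {1..m}" and B: "B \<in> \<Lambda> i" for i B
  proof (cases "trivial i")
    case True
    have "x i \<in> U i" using PiE_mem[of x _ _ i] x SU i by blast
    then obtain B' where "B' \<in> \<Lambda> i" "x i \<in> B'"
      using generalized_partitionD(1)[OF part i] by blast
    then show ?thesis using True x B by (auto simp: r_def trivial_def)
  next
    case False
    then show ?thesis
      using someI_ex[of "\<lambda>y. y \<in> S \<and> y i \<in> B"] meet[OF i B] by (auto simp: r_def)
  qed
  define W where "W i = (\<lambda>B. r i B i) ` \<Lambda> i" for i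
  have WU: "W i \<subseteq> U i" if i: "i \<in> {1..m}" for i
  proof
    fix w assume "w \<in> W i"
    then obtain B where "B \<in> \<Lambda> i" "w = r i B i" by (auto simp: W_def)
    then show "w \<in> U i" using r[OF i] SU i by (meson PiE_mem subsetD)
  qed
  have one: "\<exists>!w. w \<in> W i \<inter> B" if i: "i \<in> {1..m}" and B: "B \<in> \<Lambda> i" for i B
  proof (rule ex1I)
    show "r i B i \<in> W i \<inter> B" using r[OF i B] B by (auto simp: W_def)
  next
    fix w assume w: "w \<in> W i \<inter> B"
    then obtain B' where B': "B' \<in> \<Lambda> i" "w = r i B' i" by (auto simp: W_def)
    then have "w \<in> B'" using r[OF i] by blast
    then have "B' = B"
      using w B B' generalized_partitionD(2)[OF part i] by blast
    with B' show "w = r i B i" by simp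
  qed
  have "Pi\<^sub>E {1..m} W \<subseteq> S"
  proof
    fix w assume w: "w \<in> Pi\<^sub>E {1..m} W"
    \<comment> \<open>\<open>J\<close> collects the coordinates already exchanged;
      \<open>J = {1..m}\<close> gives \<open>w\<close> itself.\<close>
    have "override_on x w J \<in> S" if "finite J" "J \<subseteq> {1..m}" for J
      using that
    proof (induction J rule: finite_induct)
      case empty
      then show ?case using x by simp
    next
      case (insert i J)
      then have i: "i \<in> {1..m}" and IH: "override_on x w J \<in> S" by auto
      have upd: "override_on x w (insert i J) = (override_on x w J)(i := w i)"
        by (auto simp: override_on_def)
      from w i have "w i \<in> W i" by (meson PiE_mem)
      then obtain B where B: "B \<in> \<Lambda> i" "w i = r i B i" by (auto simp: W_def)
      show ?case
      proof (cases "trivial i")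
        \<comment> \<open>Here \<open>W i\<close> holds only \<open>x i\<close>, and coordinate
          \<open>i\<close> has not been touched yet.\<close>
        case True
        then have "w i = override_on x w J i" using B insert by (simp add: r_def override_on_def)
        then have "(override_on x w J)(i := w i) = override_on x w J" by (metis fun_upd_triv)
        then show ?thesis using IH upd by simp
      next
        case False
        then obtain B1 B2 where "B1 \<in> \<Lambda> i" "B2 \<in> \<Lambda> i" "B1 \<noteq> B2"
          by (auto simp: trivial_def)
        from closed[OF i this IH, of "r i B"] r[OF i B(1)] show ?thesis
          unfolding upd B(2) by blast
      qed
    qed
    from this[of "{1..m}"] have "override_on x w {1..m} \<in> S" by simp
    moreover have "override_on x w {1..m} = w"
      using w x SU by (auto simp: override_on_def fun_eq_iff PiE_def extensional_def)
    ultimately show "w \<in> S" by simp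
  qed
  moreover have "is_copy m U \<Lambda> (Pi\<^sub>E {1..m} W)"
    unfolding is_copy_def by (intro exI[of _ W] conjI ballI refl WU one)
  ultimately show ?thesis unfolding strongly_shattered_def by blast
qed

text \<open>\<open>\<Lambda>\<close> is fixed before the minimal set \<open>T\<close> is chosen.
  Filling \<open>T\<close> in a direction with two blocks gives a good subset, so minimality forces
  \<open>fill i T = T\<close>, which is the exchange property needed for a copy.\<close>

theorem ample_if_geodesic_clique_square:
  assumes fin: "finite S" and SU: "S \<subseteq> Pi\<^sub>E {1..m} U" and ne: "\<And>i. i \<in> {1..m} \<Longrightarrow> U i \<noteq> {}"
    and "geodesic_set S" "clique_closed S" "square_closed S"
  shows "ample m U S"
  unfolding ample_def
proof (intro conjI allI impI SU)
  fix \<Lambda> assume "generalized_partition m U \<Lambda> \<and> shattered m \<Lambda> S"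
  then have part: "generalized_partition m U \<Lambda>" and sh: "shattered m \<Lambda> S" by auto
  define good where "good T \<longleftrightarrow> T \<subseteq> S \<and> geodesic_set T \<and> clique_closed T \<and> square_closed T
    \<and> shattered m \<Lambda> T" for T
  have "finite {T. good T}" "S \<in> {T. good T}"
    using fin sh assms(4-6) by (auto simp: good_def intro: finite_subset[OF _ finite_Pow_iff[THEN iffD2]])
  from finite_has_minimal2[OF this] obtain T
    where T: "good T" and min: "\<And>T'. good T' \<Longrightarrow> T' \<subseteq> T \<Longrightarrow> T' = T"
    by auto
  have TU: "T \<subseteq> Pi\<^sub>E {1..m} U" using T SU by (auto simp: good_def)
  have "strongly_shattered m U \<Lambda> T"
  proof (rule strongly_shattered_if_closed[OF TU part ne])
    show "shattered m \<Lambda> T" using T by (simp add: good_def)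
  next
    fix i x y B1 B2
    assume i: "i \<in> {1..m}" and B: "B1 \<in> \<Lambda> i" "B2 \<in> \<Lambda> i" "B1 \<noteq> B2" and xy: "x \<in> T" "y \<in> T"
    have "good (fill i T)"
      using T fill_subset[of i T] shattered_fill[OF _ _ TU part _ i B] unfolding good_def
      by (auto intro: geodesic_fill clique_closed_fill square_closed_fill)
    from min[OF this fill_subset] have eq: "fill i T = T" .
    from fill_upd[of x i T y] xy show "x(i := y i) \<in> T" unfolding eq .
  qed
  moreover have "T \<subseteq> S" using T by (simp add: good_def)
  ultimately show "strongly_shattered m U \<Lambda> S"
    unfolding strongly_shattered_def by (meson subset_trans)
qed

section \<open>Graph distance, Hamming distance and coordinatewise geodesics\<close>

section \<open>Distances\<close>

text \<open>A certificate for distances to \<open>v\<close>: by \<open>lip\<close> no walk is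
  shorter than \<open>D\<close>, and following \<open>desc\<close> builds a walk of length exactly
  \<open>D\<close>.\<close>

lemma gdist_eqI:
  assumes G: "pair_wf_digraph G" and u: "u \<in> pverts G" and v: "v \<in> pverts G"
    and zero: "D v v = (0::nat)"
    and lip: "\<And>u w. (u, w) \<in> parcs G \<Longrightarrow> D u v \<le> Suc (D w v)"
    and desc: "\<And>u. u \<in> pverts G \<Longrightarrow> u \<noteq> v \<Longrightarrow> \<exists>w. (u, w) \<in> parcs G \<and> D u v = Suc (D w v)"
  shows "gdist G u v = D u v"
proof -
  interpret pair_wf_digraph G by fact
  have ex: "\<exists>p. awalk u p v \<and> length p = D u v"
    using u
  proof (induction "D u v" arbitrary: u)
    case 0
    then have "u = v" using desc by fastforce
    then show ?case using zero v by (auto simp: awalk_Nil_iff)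
  next
    case (Suc n)
    then obtain w where w: "(u, w) \<in> parcs G" "D u v = Suc (D w v)"
      using desc[of u] zero by fastforce
    then obtain p where "awalk w p v" "length p = D w v"
      using Suc in_arcsD2 by fastforce
    then have "awalk u ((u, w) # p) v \<and> length ((u, w) # p) = D u v"
      using w by (simp add: awalk_Cons_iff)
    then show ?case by blast
  qed
  have all: "D u v \<le> length p" if "awalk u p v" for p
    using that
  proof (induction p arbitrary: u)
    case Nil
    then show ?case using zero by (simp add: awalk_Nil_iff)
  next
    case (Cons e p)
    then show ?case using lip[of "fst e" "snd e"] by (fastforce simp: awalk_Cons_iff)
  qed
  show ?thesis
    unfolding gdist_def using ex all by (intro cInf_eq_minimum) (auto simp: image_iff)
qed

text \<open>Connectedness makes the set of walk lengths nonempty, so its infimum is attained. It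
  speaks of the symmetric closure, which has the same reachability here because arcs are
  symmetric.\<close>

lemma gdist_awalk:
  assumes "pair_graph G" "connected (with_proj G)" "u \<in> pverts G" "v \<in> pverts G"
  obtains p where "pre_digraph.awalk (with_proj G) u p v" "length p = gdist G u v"
proof -
  interpret pair_graph G by fact
  have "u \<rightarrow>\<^sup>*\<^bsub>with_proj (mk_symmetric (with_proj G))\<^esub> v"
    using assms(2-4) unfolding connected_def strongly_connected_def by auto
  then have "u \<rightarrow>\<^sup>*\<^bsub>with_proj G\<^esub> v" using reachable_mk_symmetric_eq[OF pair_sym_arcs] by simp
  then have "length ` {p. awalk u p v} \<noteq> {}" by (auto simp: reachable_awalk)
  from Inf_nat_def1[OF this] that show thesis unfolding gdist_def by auto
qed

lemma gdist_le_length: "pre_digraph.awalk (with_proj G) u p v \<Longrightarrow> gdist G u v \<le> length p"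
  unfolding gdist_def by (intro cInf_lower) auto

text \<open>The first arc of a shortest walk.\<close>

lemma gdist_step:
  assumes "pair_graph G" "connected (with_proj G)" "u \<in> pverts G" "v \<in> pverts G" "u \<noteq> v"
  obtains w where "w \<in> pverts G" "(u, w) \<in> parcs G" "gdist G u w \<le> 1" "gdist G w v < gdist G u v"
proof -
  interpret pair_graph G by fact
  obtain p where p: "awalk u p v" "length p = gdist G u v"
    using gdist_awalk[OF assms(1-4)] by blast
  with \<open>u \<noteq> v\<close> obtain e q where e: "p = e # q"
    by (cases p) (auto simp: awalk_Nil_iff)
  define w where "w = snd e"
  have uw: "(u, w) \<in> parcs G" and q: "awalk w q v"
    using p e by (auto simp: awalk_Cons_iff w_def)
  have w: "w \<in> pverts G" using uw in_arcsD2 by blast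
  have "awalk u [(u, w)] w" using uw w by (simp add: awalk_Cons_iff awalk_Nil_iff)
  from gdist_le_length[OF this] gdist_le_length[OF q] p e that[OF w uw] show thesis
    by simp
qed

text \<open>A sum of indicators instead of a cardinality, so that equalities of distances can be
  compared coordinate by coordinate.\<close>

definition hdist :: "nat \<Rightarrow> (nat \<Rightarrow> 'a) \<Rightarrow> (nat \<Rightarrow> 'a) \<Rightarrow> nat" where
  "hdist m x y = (\<Sum>i\<in>{1..m}. of_bool (x i \<noteq> y i))"

lemma hdist_self [simp]: "hdist m x x = 0"
  by (simp add: hdist_def)

lemma hdist_commute: "hdist m x y = hdist m y x"
  unfolding hdist_def by (simp only: eq_commute)

text \<open>Both indicators are added, which avoids subtraction of naturals.\<close>

lemma hdist_fun_upd:
  assumes "j \<in> {1..m}"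
  shows "hdist m (x(j := b)) y + of_bool (x j \<noteq> y j) = hdist m x y + of_bool (b \<noteq> y j)"
proof -
  have remove: "hdist m z y = of_bool (z j \<noteq> y j) + (\<Sum>i\<in>{1..m} - {j}. of_bool (z i \<noteq> y i))" for z
    unfolding hdist_def using assms by (intro sum.remove) auto
  have rest: "(\<Sum>i\<in>{1..m} - {j}. of_bool ((x(j := b)) i \<noteq> y i))
      = (\<Sum>i\<in>{1..m} - {j}. of_bool (x i \<noteq> y i) :: nat)"
    by (intro sum.cong) auto
  show ?thesis
    unfolding remove[of "x(j := b)"] remove[of x] rest by (simp only: fun_upd_same ac_simps)
qed

lemma hdist_le_1D:
  assumes "hdist m x y \<le> 1" "x i \<noteq> y i" "i \<in> {1..m}" "j \<in> {1..m}" "j \<noteq> i"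
  shows "x j = y j"
proof (rule ccontr)
  assume "x j \<noteq> y j"
  then have "(\<Sum>l\<in>{i, j}. of_bool (x l \<noteq> y l)) = (2::nat)" using assms by simp
  moreover have "(\<Sum>l\<in>{i, j}. of_bool (x l \<noteq> y l)) \<le> hdist m x y"
    unfolding hdist_def using assms by (intro sum_mono2) auto
  ultimately show False using assms by linarith
qed

text \<open>The triangle inequality holds in each coordinate; strictness in one of them would make
  the sums differ.\<close>

lemma hdist_additive:
  assumes "hdist m x y = hdist m x v + hdist m v w + hdist m w y" "i \<in> {1..m}"
  shows "of_bool (x i \<noteq> y i) = (of_bool (x i \<noteq> v i) + of_bool (v i \<noteq> w i) + of_bool (w i \<noteq> y i) :: nat)"
proof (rule ccontr)
  let ?f = "\<lambda>i. of_bool (x i \<noteq> y i) :: nat"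
  let ?g = "\<lambda>i. of_bool (x i \<noteq> v i) + of_bool (v i \<noteq> w i) + of_bool (w i \<noteq> y i) :: nat"
  assume "?f i \<noteq> ?g i"
  moreover have le: "?f i \<le> ?g i" for i by auto
  ultimately have "sum ?f {1..m} < sum ?g {1..m}"
    using assms(2) by (intro sum_strict_mono_ex1) (auto intro!: bexI[of _ i] simp: order.strict_iff_order)
  with assms(1) show False by (simp add: hdist_def sum.distrib)
qed

text \<open>\<open>x\<close>, \<open>v\<close>, \<open>w\<close>, \<open>y\<close> lie in this order
  on a Hamming geodesic: each coordinate switches at most once, from its value in \<open>x\<close>
  to that in \<open>y\<close>.\<close>

definition on_geodesic :: "('i \<Rightarrow> 'a) \<Rightarrow> ('i \<Rightarrow> 'a) \<Rightarrow> ('i \<Rightarrow> 'a) \<Rightarrow> ('i \<Rightarrow> 'a) \<Rightarrow> bool" where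
  "on_geodesic x v w y \<longleftrightarrow>
     (\<forall>i. v i = x i \<and> w i = x i \<or> v i = x i \<and> w i = y i \<or> v i = y i \<and> w i = y i)"

lemma on_geodesicD:
  "on_geodesic x v w y \<Longrightarrow> v i = x i \<and> w i = x i \<or> v i = x i \<and> w i = y i \<or> v i = y i \<and> w i = y i"
  by (simp add: on_geodesic_def)

lemma on_geodesicI:
  assumes "hdist m x y = hdist m x v + hdist m v w + hdist m w y"
    and "\<And>i. i \<notin> {1..m} \<Longrightarrow> x i = y i \<and> v i = y i \<and> w i = y i"
  shows "on_geodesic x v w y"
  unfolding on_geodesic_def
proof
  fix i
  show "v i = x i \<and> w i = x i \<or> v i = x i \<and> w i = y i \<or> v i = y i \<and> w i = y i"
  proof (cases "i \<in> {1..m}")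
    case True
    from hdist_additive[OF assms(1) this] show ?thesis
      by (cases "x i = v i"; cases "v i = w i"; cases "w i = y i") (auto simp: of_bool_def split: if_splits)
  next
    case False
    from assms(2)[OF this] show ?thesis by simp
  qed
qed

text \<open>An arc changes one indicator, and correcting any wrong coordinate lowers the count by
  one.\<close>

lemma gdist_hamming_graph:
  assumes x: "x \<in> Pi\<^sub>E {1..m} U" and y: "y \<in> Pi\<^sub>E {1..m} U"
  shows "gdist (hamming_graph m U) x y = hdist m x y"
proof (rule gdist_eqI)
  show "pair_wf_digraph (hamming_graph m U)"
    by unfold_locales (auto simp: hamming_graph_def)
  show "x \<in> pverts (hamming_graph m U)" "y \<in> pverts (hamming_graph m U)"
    using x y by (simp_all add: hamming_graph_def)
next
  fix u w assume "(u, w) \<in> parcs (hamming_graph m U)"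
  then have uv: "u \<in> Pi\<^sub>E {1..m} U" "w \<in> Pi\<^sub>E {1..m} U" and "\<exists>!l. l \<in> {1..m} \<and> u l \<noteq> w l"
    by (simp_all add: hamming_graph_def)
  from this(3) obtain j where "j \<in> {1..m} \<and> u j \<noteq> w j"
    and "\<forall>l. l \<in> {1..m} \<and> u l \<noteq> w l \<longrightarrow> l = j" by (rule ex1E)
  then have j: "j \<in> {1..m}" and eq: "\<And>l. l \<in> {1..m} \<Longrightarrow> u l \<noteq> w l \<Longrightarrow> l = j"
    by blast+
  have "u l = w l" if "l \<noteq> j" for l
    using that PiE_neq_mem[OF uv] eq by metis
  then have "u = w(j := u j)" by (simp add: fun_eq_iff)
  then have "hdist m u y + of_bool (w j \<noteq> y j) = hdist m w y + of_bool (u j \<noteq> y j)"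
    using hdist_fun_upd[OF j, of w "u j" y] by simp
  then show "hdist m u y \<le> Suc (hdist m w y)" by (auto simp: of_bool_def split: if_splits)
next
  fix u assume u: "u \<in> pverts (hamming_graph m U)" "u \<noteq> y"
  then have uU: "u \<in> Pi\<^sub>E {1..m} U" by (simp add: hamming_graph_def)
  obtain j where j: "u j \<noteq> y j" using u(2) by (auto simp: fun_eq_iff)
  from PiE_neq_mem[OF uU y this] have jm: "j \<in> {1..m}" .
  have "u(j := y j) \<in> Pi\<^sub>E {1..m} U"
    using uU y jm by (auto simp: PiE_def extensional_def Pi_def)
  then have "(u, u(j := y j)) \<in> parcs (hamming_graph m U)"
    using uU jm j unfolding hamming_graph_def
    by (simp del: fun_upd_apply) (rule ex1I[of _ j], auto split: if_splits)
  moreover have "hdist m u y = Suc (hdist m (u(j := y j)) y)"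
    using hdist_fun_upd[OF jm, of u "y j" y] j by simp
  ultimately show "\<exists>w. (u, w) \<in> parcs (hamming_graph m U) \<and> hdist m u y = Suc (hdist m w y)"
    by blast
qed simp

lemma pverts_cycle_graph: "pverts (cycle_graph n) = {..<n}"
  by (simp add: cycle_graph_def)

text \<open>
  The three indicator functions place the cycle in the 3-cube as
  010, 000, 100, 101, 111, 011, avoiding the antipodal corners 110 and 001.
\<close>
lemma gdist_cycle_graph_6:
  assumes "s < 6" "t < 6"
  shows "gdist (cycle_graph 6) s t = of_bool ((s \<in> {2, 3, 4}) \<noteq> (t \<in> {2, 3, 4}))
    + of_bool ((s \<in> {0, 4, 5}) \<noteq> (t \<in> {0, 4, 5})) + of_bool ((s \<in> {3, 4, 5}) \<noteq> (t \<in> {3, 4, 5}))"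
    (is "_ = ?D s t")
proof (rule gdist_eqI[where D = ?D])
  have lt6: "n < 6 \<longleftrightarrow> n = 0 \<or> n = 1 \<or> n = 2 \<or> n = 3 \<or> n = 4 \<or> n = 5" for n :: nat
    by linarith
  show "pair_wf_digraph (cycle_graph 6)"
    by unfold_locales (auto simp: cycle_graph_def)
  show "s \<in> pverts (cycle_graph 6)" "t \<in> pverts (cycle_graph 6)"
    using assms by (simp_all add: cycle_graph_def)
  show "?D t t = 0" by simp
  show "?D u t \<le> Suc (?D w t)" if "(u, w) \<in> parcs (cycle_graph 6)" for u w
  proof -
    have "u < 6" "w < 6" "w = Suc u mod 6 \<or> u = Suc w mod 6"
      using that by (auto simp: cycle_graph_def)
    then show ?thesis unfolding lt6 by (elim disjE) (simp_all add: of_bool_def)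
  qed
  show "\<exists>w. (u, w) \<in> parcs (cycle_graph 6) \<and> ?D u t = Suc (?D w t)"
    if "u \<in> pverts (cycle_graph 6)" "u \<noteq> t" for u
  proof -
    have u: "u < 6" using that by (simp add: cycle_graph_def)
    \<comment> \<open>Adding 5 is the step backwards on the cycle, also at 0. One of the two
      neighbours of \<open>u\<close> is closer to \<open>t\<close>.\<close>
    have "u = Suc ((u + 5) mod 6) mod 6" using u unfolding lt6 by (elim disjE) simp_all
    then have "(u, Suc u mod 6) \<in> parcs (cycle_graph 6)" "(u, (u + 5) mod 6) \<in> parcs (cycle_graph 6)"
      using u by (simp_all add: cycle_graph_def)
    moreover have "?D u t = Suc (?D (Suc u mod 6) t) \<or> ?D u t = Suc (?D ((u + 5) mod 6) t)"
      using u \<open>t < 6\<close> \<open>u \<noteq> t\<close> unfolding lt6 by (elim disjE) simp_all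
    ultimately show ?thesis by blast
  qed
qed

section \<open>The three closure conditions derived from quasi-medians\<close>

section \<open>Quasi-median subgraphs of Hamming graphs\<close>

locale quasi_median_in_hamming =
  fixes m :: nat and U :: "nat \<Rightarrow> 'a set"
    and G :: "'v pair_pre_digraph" and \<phi> :: "'v \<Rightarrow> nat \<Rightarrow> 'a"
  assumes qm: "quasi_median_graph G"
    and iso: "isometric_embedding \<phi> G (hamming_graph m U)"
begin

definition S where "S = \<phi> ` pverts G"

lemma graph: "pair_graph G" and conn: "connected (with_proj G)"
  using qm by (auto simp: quasi_median_graph_def)

lemma S_subset: "S \<subseteq> Pi\<^sub>E {1..m} U"
  using iso by (simp add: S_def isometric_embedding_def hamming_graph_def)

lemma gdist_eq_hdist:
  assumes "u \<in> pverts G" "v \<in> pverts G"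
  shows "gdist G u v = hdist m (\<phi> u) (\<phi> v)"
proof -
  have "\<phi> u \<in> Pi\<^sub>E {1..m} U" "\<phi> v \<in> Pi\<^sub>E {1..m} U" using assms S_subset by (auto simp: S_def)
  from gdist_hamming_graph[OF this] iso assms show ?thesis
    unfolding isometric_embedding_def by metis
qed

lemma outside: "x \<in> S \<Longrightarrow> y \<in> S \<Longrightarrow> i \<notin> {1..m} \<Longrightarrow> x i = y i"
  using S_subset PiE_arb by (metis subsetD)

lemma neq_mem: "x \<in> S \<Longrightarrow> y \<in> S \<Longrightarrow> x i \<noteq> y i \<Longrightarrow> i \<in> {1..m}"
  using outside by blast

lemma inj_phi: "inj_on \<phi> (pverts G)"
proof (rule inj_onI)
  fix u v assume u: "u \<in> pverts G" and v: "v \<in> pverts G" and eq: "\<phi> u = \<phi> v"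
  show "u = v"
  proof (rule ccontr)
    assume "u \<noteq> v"
    from gdist_step[OF graph conn u v this] gdist_eq_hdist[OF u v] eq show False
      by (metis hdist_self not_less_zero)
  qed
qed

text \<open>The image of the first vertex on a shortest walk differs from \<open>x\<close> in one
  coordinate; since the distance to \<open>y\<close> drops, its new value there must be that of
  \<open>y\<close>.\<close>

lemma geodesic: "geodesic_set S"
  unfolding geodesic_set_def
proof (intro ballI impI)
  fix x y assume "x \<in> S" "y \<in> S" "x \<noteq> y"
  then obtain u v where u: "u \<in> pverts G" "x = \<phi> u" and v: "v \<in> pverts G" "y = \<phi> v" and "u \<noteq> v"
    by (auto simp: S_def)
  obtain w where w: "w \<in> pverts G" "gdist G u w \<le> 1" "gdist G w v < gdist G u v"
    using gdist_step[OF graph conn u(1) v(1) \<open>u \<noteq> v\<close>] by blast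
  define z where "z = \<phi> w"
  have z: "z \<in> S" using w by (simp add: S_def z_def)
  have xz: "hdist m x z \<le> 1" and zy: "hdist m z y < hdist m x y"
    using w u v by (simp_all add: gdist_eq_hdist z_def)
  from zy have "x \<noteq> z" by auto
  then obtain j where j: "x j \<noteq> z j" by (auto simp: fun_eq_iff)
  have jm: "j \<in> {1..m}" using neq_mem[OF \<open>x \<in> S\<close> z j] .
  have "x l = z l" if "l \<noteq> j" for l
    using hdist_le_1D[OF xz j jm _ that] outside[OF \<open>x \<in> S\<close> z] by blast
  then have eq: "x(j := z j) = z" by (auto simp: fun_eq_iff)
  have "hdist m z y + of_bool (x j \<noteq> y j) = hdist m x y + of_bool (z j \<noteq> y j)"
    using hdist_fun_upd[OF jm, of x "z j" y] eq by simp
  with zy have "x j \<noteq> y j" "z j = y j" by (auto simp: of_bool_def split: if_splits)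
  with eq z show "\<exists>j. x j \<noteq> y j \<and> x(j := y j) \<in> S" by metis
qed

text \<open>Under the isometry the three distance equations of a quasi-median become coordinatewise
  conditions on tuples of \<open>S\<close>.\<close>

lemma quasi_median_coordinates:
  assumes "x \<in> S" "y \<in> S" "z \<in> S"
  obtains a b c where "a \<in> S" "b \<in> S" "c \<in> S"
    and "hdist m a b = hdist m b c" "hdist m b c = hdist m c a"
    and "on_geodesic x a b y" "on_geodesic y b c z" "on_geodesic z c a x"
proof -
  obtain u1 u2 u3 where u: "u1 \<in> pverts G" "u2 \<in> pverts G" "u3 \<in> pverts G"
    "x = \<phi> u1" "y = \<phi> u2" "z = \<phi> u3"
    using assms by (auto simp: S_def)
  then have "(u1, u2, u3) \<in> pverts G \<times> pverts G \<times> pverts G" by simp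
  then obtain v1 v2 v3 where qmv: "quasi_median G (u1, u2, u3) (v1, v2, v3)"
    and eqv: "equilateral G v1 v2 v3"
    using qm unfolding quasi_median_graph_def by (metis prod_cases3)
  then have v: "v1 \<in> pverts G" "v2 \<in> pverts G" "v3 \<in> pverts G"
    by (simp_all add: quasi_median_def metric_triangle_def)
  have S: "\<phi> v1 \<in> S" "\<phi> v2 \<in> S" "\<phi> v3 \<in> S" using v by (simp_all add: S_def)
  have d: "hdist m x y = hdist m x (\<phi> v1) + hdist m (\<phi> v1) (\<phi> v2) + hdist m (\<phi> v2) y"
    "hdist m y z = hdist m y (\<phi> v2) + hdist m (\<phi> v2) (\<phi> v3) + hdist m (\<phi> v3) z"
    "hdist m z x = hdist m z (\<phi> v3) + hdist m (\<phi> v3) (\<phi> v1) + hdist m (\<phi> v1) x"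
    using qmv u v by (simp_all add: quasi_median_def gdist_eq_hdist)
  have e: "hdist m (\<phi> v1) (\<phi> v2) = hdist m (\<phi> v2) (\<phi> v3)"
    "hdist m (\<phi> v2) (\<phi> v3) = hdist m (\<phi> v3) (\<phi> v1)"
    using eqv v by (simp_all add: equilateral_def gdist_eq_hdist)
  have out: "i \<notin> {1..m} \<Longrightarrow> y i = x i \<and> z i = x i \<and> \<phi> v1 i = x i \<and> \<phi> v2 i = x i \<and> \<phi> v3 i = x i" for i
    using outside assms S by blast
  show thesis
  proof (rule that[OF S e])
    show "on_geodesic x (\<phi> v1) (\<phi> v2) y"
      by (rule on_geodesicI[OF d(1)]) (simp add: out)
    show "on_geodesic y (\<phi> v2) (\<phi> v3) z"
      by (rule on_geodesicI[OF d(2)]) (simp add: out)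
    show "on_geodesic z (\<phi> v3) (\<phi> v1) x"
      by (rule on_geodesicI[OF d(3)]) (simp add: out)
  qed
qed

text \<open>The quasi-median of \<open>x\<close>, \<open>x(i := b)\<close> and \<open>y\<close>
  keeps its first two corners. Equilaterality then puts the third at distance 1 from
  \<open>x\<close>, and it has the value \<open>y i\<close> at \<open>i\<close>.\<close>

lemma clique: "clique_closed S"
  unfolding clique_closed_def
proof (intro ballI allI impI)
  fix x y i b
  assume x: "x \<in> S" and y: "y \<in> S" and b: "b \<noteq> x i" and x': "x(i := b) \<in> S"
  have i: "i \<in> {1..m}" using neq_mem[OF x x', of i] b by auto
  show "x(i := y i) \<in> S"
  proof (cases "y i = x i \<or> y i = b")
    case True
    then show ?thesis using x x' by (metis fun_upd_triv)
  next
    case False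
    obtain v1 v2 v3
      where v: "v1 \<in> S" "v2 \<in> S" "v3 \<in> S"
        and eq: "hdist m v1 v2 = hdist m v2 v3" "hdist m v2 v3 = hdist m v3 v1"
        and c1: "on_geodesic x v1 v2 (x(i := b))" and c2: "on_geodesic (x(i := b)) v2 v3 y"
        and c3: "on_geodesic y v3 v1 x"
      by (rule quasi_median_coordinates[OF x x' y])
    \<comment> \<open>Each corner takes a value at \<open>i\<close> common to two of the pairs
      formed from the distinct values \<open>x i\<close>, \<open>b\<close>,
      \<open>y i\<close>.\<close>
    have at_i: "v1 i = x i \<and> v2 i = b \<and> v3 i = y i"
      using on_geodesicD[OF c1, of i] on_geodesicD[OF c2, of i] on_geodesicD[OF c3, of i] b False by auto
    have off_i: "v1 l = x l \<and> v2 l = x l" if "l \<noteq> i" for l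
      using on_geodesicD[OF c1, of l] that by auto
    have v1: "v1 = x" and v2: "v2 = x(i := b)"
      unfolding fun_eq_iff using at_i off_i by (metis, metis fun_upd_apply)
    have "hdist m v1 v2 = 1"
      unfolding v1 v2 hdist_commute[of m x] using hdist_fun_upd[OF i, of x b x] b by simp
    with eq have d: "hdist m v3 v1 \<le> 1" by simp
    have "v3 l = x l" if l: "l \<noteq> i" for l
    proof (cases "l \<in> {1..m}")
      case True
      have "v3 i \<noteq> v1 i" using at_i False by simp
      from hdist_le_1D[OF d this i True l] v1 show ?thesis by simp
    next
      case False
      then show ?thesis using outside v(3) x by blast
    qed
    then have "v3 = x(i := y i)" using at_i by (auto simp: fun_eq_iff)
    with v show ?thesis by simp
  qed
qed

text \<open>
  The hull of the 6-cycle lies in the Hamming box of the eight corners; being a 3-cube, it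
  contains all of them.
\<close>
lemma six_cycle:
  assumes ijk: "i \<in> {1..m}" "j \<in> {1..m}" "k \<in> {1..m}" "i \<noteq> j" "i \<noteq> k" "j \<noteq> k"
    and abc: "a \<noteq> x i" "b \<noteq> x j" "c \<noteq> x k"
    and mem: "x \<in> S" "x(i := a) \<in> S" "x(j := b) \<in> S" "x(i := a, k := c) \<in> S"
      "x(j := b, k := c) \<in> S" "x(i := a, j := b, k := c) \<in> S"
  shows "x(i := a, j := b) \<in> S"
proof -
  define corner where "corner p q r =
    x(i := if p then a else x i, j := if q then b else x j, k := if r then c else x k)" for p q r
  have corner_at: "corner p q r i = (if p then a else x i)" "corner p q r j = (if q then b else x j)"
    "corner p q r k = (if r then c else x k)" for p q r
    using ijk by (simp_all add: corner_def)
  have corner_off: "corner p q r l = x l" if "l \<notin> {i, j, k}" for p q r l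
    using that by (simp add: corner_def)
  have hdist_corner: "hdist m (corner p q r) (corner p' q' r')
      = of_bool (p \<noteq> p') + of_bool (q \<noteq> q') + of_bool (r \<noteq> r')" for p q r p' q' r'
  proof -
    have "hdist m (corner p q r) (corner p' q' r')
        = (\<Sum>l\<in>{i, j, k}. of_bool (corner p q r l \<noteq> corner p' q' r' l))"
      unfolding hdist_def using ijk by (intro sum.mono_neutral_right) (auto simp: corner_off)
    also have "\<dots> = of_bool (p \<noteq> p') + of_bool (q \<noteq> q') + of_bool (r \<noteq> r')"
      using ijk abc by (simp add: corner_at)
    finally show ?thesis .
  qed
  \<comment> \<open>The indicators are those of \<open>gdist_cycle_graph_6\<close>, so both
    distances are given by the same formula.\<close>
  define \<gamma> where "\<gamma> s = corner (s \<in> {2, 3, 4}) (s \<in> {0, 4, 5}) (s \<in> {3, 4, 5})" for s :: nat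
  have \<gamma>S: "\<gamma> s \<in> S" if "s < 6" for s
  proof -
    have "s \<in> {0, 1, 2, 3, 4, 5}" using that by auto
    then show ?thesis using mem ijk by (auto simp: \<gamma>_def corner_def fun_upd_idem)
  qed
  define d where "d s = inv_into (pverts G) \<phi> (\<gamma> s)" for s
  have d: "d s \<in> pverts G" "\<phi> (d s) = \<gamma> s" if "s < 6" for s
    using \<gamma>S[OF that] by (auto simp: d_def S_def inv_into_into f_inv_into_f)
  have "isometric_embedding d (cycle_graph 6) G"
    unfolding isometric_embedding_def
    using d by (auto simp: pverts_cycle_graph gdist_cycle_graph_6 gdist_eq_hdist hdist_corner \<gamma>_def)
  define K where "K = geodesically_convex G hull (d ` pverts (cycle_graph 6))"
  have "digraph_iso (with_proj G \<restriction> K) (with_proj (cube_graph 3))"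
    using qm \<open>isometric_embedding d (cycle_graph 6) G\<close> unfolding quasi_median_graph_def K_def by blast
  then have "\<exists>f. inj_on f K \<and> pverts (cube_graph 3) = f ` K"
    unfolding digraph_iso_def pre_digraph.digraph_isomorphism_def
    by (metis induce_subgraph_verts verts_app_iso with_proj_simps(1))
  \<comment> \<open>Of the isomorphism with the cube, only the number of vertices is kept.\<close>
  then have "card K = card (pverts (cube_graph 3))" by (metis card_image)
  also have "\<dots> = 8"
    by (simp add: cube_graph_def hamming_graph_def card_PiE)
  finally have card_K: "card K = 8" .
  define C where "C = (\<lambda>(p, q, r). corner p q r) ` UNIV"
  have corner_C: "corner p q r \<in> C" for p q r
    unfolding C_def by (rule image_eqI[of _ _ "(p, q, r)"]) simp_all
  have "card C \<le> card (UNIV :: (bool \<times> bool \<times> bool) set)"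
    unfolding C_def by (rule card_image_le) simp
  also have "\<dots> = 8" by (simp add: card_cartesian_product flip: UNIV_Times_UNIV)
  finally have card_C: "card C \<le> 8" .
  have "geodesically_convex G {v \<in> pverts G. \<phi> v \<in> C}"
    unfolding geodesically_convex_def
  proof (intro conjI ballI subsetI)
    fix u v w
    assume "u \<in> {v \<in> pverts G. \<phi> v \<in> C}" "v \<in> {v \<in> pverts G. \<phi> v \<in> C}" "w \<in> interval G u v"
    \<comment> \<open>The zero middle term casts betweenness in the four-point form of
      \<open>hdist_additive\<close>.\<close>
    then have uvw: "u \<in> pverts G" "v \<in> pverts G" "w \<in> pverts G" "\<phi> u \<in> C" "\<phi> v \<in> C"
      and between: "hdist m (\<phi> u) (\<phi> v) = hdist m (\<phi> u) (\<phi> w) + hdist m (\<phi> w) (\<phi> w) + hdist m (\<phi> w) (\<phi> v)"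
      using gdist_eq_hdist[of u v] gdist_eq_hdist[of u w] gdist_eq_hdist[of w v]
      by (simp_all add: interval_def)
    have S: "\<phi> u \<in> S" "\<phi> w \<in> S" using uvw by (auto simp: S_def)
    have cases: "\<phi> w l = \<phi> u l \<or> \<phi> w l = \<phi> v l" for l
    proof (cases "l \<in> {1..m}")
      case True
      from hdist_additive[OF between True] show ?thesis by (auto simp: of_bool_def split: if_splits)
    qed (use outside S in blast)
    obtain p q r p' q' r' where uv: "\<phi> u = corner p q r" "\<phi> v = corner p' q' r'"
      using uvw by (auto simp: C_def)
    have "\<phi> w = corner (\<phi> w i = a) (\<phi> w j = b) (\<phi> w k = c)"
    proof
      fix l
      show "\<phi> w l = corner (\<phi> w i = a) (\<phi> w j = b) (\<phi> w k = c) l"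
        using cases[of l] uv by (cases "l \<in> {i, j, k}") (auto simp: corner_at corner_off split: if_splits)
    qed
    then have "\<phi> w \<in> C" using corner_C by metis
    with uvw show "w \<in> {v \<in> pverts G. \<phi> v \<in> C}" by simp
  qed simp
  moreover have "d ` pverts (cycle_graph 6) \<subseteq> {v \<in> pverts G. \<phi> v \<in> C}"
    using d corner_C by (auto simp: pverts_cycle_graph \<gamma>_def)
  ultimately have K: "K \<subseteq> {v \<in> pverts G. \<phi> v \<in> C}"
    unfolding K_def by (rule hull_minimal[rotated])
  then have "K \<subseteq> pverts G" by auto
  \<comment> \<open>Eight hull vertices map injectively into at most eight corners, so every corner
    is hit, including the one off the cycle that is wanted.\<close>
  from card_image[OF inj_on_subset[OF inj_phi this]] card_K have "card (\<phi> ` K) = 8" by simp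
  moreover have "\<phi> ` K \<subseteq> C" "finite C" using K by (auto simp: C_def)
  ultimately have "\<phi> ` K = C" using card_C by (metis card_seteq)
  moreover have "corner True True False \<in> C" by (rule corner_C)
  ultimately have "corner True True False \<in> S" using K by (auto simp: S_def)
  moreover have "corner True True False = x(i := a, j := b)" using ijk by (auto simp: corner_def)
  ultimately show ?thesis by simp
qed

text \<open>
  Apart from the wanted tuple itself, equilaterality leaves one possible quasi-median of
  \<open>x(j := y j)\<close>, \<open>x(i := y i)\<close> and \<open>y\<close>: the first two of these with a
  tuple differing from the wanted one in a single further coordinate. Closing these up by
  geodesics gives the isometric 6-cycle of \<open>six_cycle\<close>.
\<close>
lemma square: "square_closed S"
  unfolding square_closed_def
proof (intro ballI allI impI)
  fix x y i j
  assume x: "x \<in> S" and y: "y \<in> S" and xi: "x(i := y i) \<in> S" and xj: "x(j := y j) \<in> S"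
  define p where "p = x(i := y i)"
  define u where "u = x(j := y j)"
  define z where "z = x(i := y i, j := y j)"
  have pu: "p \<in> S" "u \<in> S" using xi xj by (simp_all add: p_def u_def)
  have "z \<in> S"
  proof (cases "i = j \<or> x i = y i \<or> x j = y j")
    case True
    then show ?thesis
      using xi xj unfolding z_def by (metis fun_upd_triv fun_upd_twist fun_upd_upd)
  next
    case False
    then have ij: "i \<noteq> j" and a: "x i \<noteq> y i" and b: "x j \<noteq> y j" by auto
    have im: "i \<in> {1..m}" and jm: "j \<in> {1..m}" using neq_mem[OF x y] a b by blast+
    have p_at: "p i = y i" "p j = x j" and u_at: "u i = x i" "u j = y j"
      and z_at: "z i = y i" "z j = y j"
      using ij by (simp_all add: p_def u_def z_def)
    have off: "p l = x l" "u l = x l" "z l = x l" if "l \<noteq> i" "l \<noteq> j" for l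
      using that by (simp_all add: p_def u_def z_def)
    obtain v1 v2 v3
      where v: "v1 \<in> S" "v2 \<in> S" "v3 \<in> S"
        and eq: "hdist m v1 v2 = hdist m v2 v3" "hdist m v2 v3 = hdist m v3 v1"
        and c1: "on_geodesic u v1 v2 p" and c2: "on_geodesic p v2 v3 y"
        and c3: "on_geodesic y v3 v1 u"
      by (rule quasi_median_coordinates[OF pu(2,1) y])
    have v_i: "v2 i = y i" "v3 i = y i" "v1 i = x i \<or> v1 i = y i"
      using on_geodesicD[OF c1, of i] on_geodesicD[OF c2, of i] by (auto simp: p_at u_at)
    have v_j: "v1 j = y j" "v3 j = y j" "v2 j = x j \<or> v2 j = y j"
      using on_geodesicD[OF c1, of j] on_geodesicD[OF c3, of j] by (auto simp: p_at u_at)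
    have v_off: "v1 l = x l" "v2 l = x l" if "l \<noteq> i" "l \<noteq> j" for l
      using on_geodesicD[OF c1, of l] that by (auto simp: off)
    \<comment> \<open>In the first two cases a corner of the quasi-median is \<open>z\<close>
      itself; the third is the exceptional one.\<close>
    consider "v1 i = y i" | "v2 j = y j" | "v1 i = x i" "v2 j = x j" using v_i v_j by blast
    then show ?thesis
    proof cases
      case 1
      have "v1 = z"
      proof
        fix l show "v1 l = z l"
          using 1 v_j v_off[of l] off[of l] z_at by (cases "l = i"; cases "l = j") auto
      qed
      with v show ?thesis by simp
    next
      case 2
      have "v2 = z"
      proof
        fix l show "v2 l = z l"
          using 2 v_i v_off[of l] off[of l] z_at by (cases "l = i"; cases "l = j") auto
      qed
      with v show ?thesis by simp
    next
      case 3
      have v1: "v1 = u"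
      proof
        fix l show "v1 l = u l"
          using 3 v_j v_off[of l] off[of l] u_at by (cases "l = i"; cases "l = j") auto
      qed
      have v2: "v2 = p"
      proof
        fix l show "v2 l = p l"
          using 3 v_i v_off[of l] off[of l] p_at by (cases "l = i"; cases "l = j") auto
      qed
      have zp: "z = p(j := y j)" by (simp add: z_def p_def)
      have zu: "z = u(i := y i)" using ij by (simp add: z_def u_def fun_upd_twist)
      \<comment> \<open>\<open>p\<close> and \<open>u\<close> are at distance 2, hence so are
        \<open>p\<close> and \<open>v3\<close> by equilaterality. Since \<open>v3\<close> has
        \<open>y j\<close> at \<open>j\<close>, moving from \<open>p\<close> to \<open>z\<close>
        saves one.\<close>
      have "hdist m z u = 1"
        using hdist_fun_upd[OF im, of u "y i" u] a u_at zu by simp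
      moreover have "hdist m z u + 1 = hdist m p u"
        using hdist_fun_upd[OF jm, of p "y j" u] b u_at p_at zp by simp
      moreover have "hdist m z v3 + 1 = hdist m p v3"
        using hdist_fun_upd[OF jm, of p "y j" v3] b v_j p_at zp by simp
      ultimately have dz: "hdist m z v3 = 1"
        using eq v1 v2 hdist_commute[of m p u] by simp
      then have "z \<noteq> v3" by auto
      then obtain k where k: "z k \<noteq> v3 k" by (auto simp: fun_eq_iff)
      then have ki: "k \<noteq> i" and kj: "k \<noteq> j" using z_at v_i v_j by auto
      have xk: "v3 k \<noteq> x k" using k off ki kj by simp
      have km: "k \<in> {1..m}" using neq_mem[OF v(3) x xk] .
      have "z l = v3 l" if "l \<noteq> k" for l
      proof (cases "l \<in> {1..m}")
        case True
        then show ?thesis using hdist_le_1D[OF eq_imp_le[OF dz] k km True that] by simp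
      next
        case False
        then show ?thesis
          using outside[OF v(3) x False] off[of l] im jm by (cases "l = i"; cases "l = j") auto
      qed
      then have v3: "v3 = z(k := v3 k)" by (auto simp: fun_eq_iff)
      show ?thesis
      proof (rule ccontr)
        assume nz: "z \<notin> S"
        \<comment> \<open>\<open>p\<close> and \<open>v3\<close> differ only at \<open>j\<close> and
          \<open>k\<close>. A geodesic step at \<open>j\<close> would produce \<open>z\<close>, so
          it is made at \<open>k\<close>; likewise from \<open>u\<close>, with \<open>i\<close> in
          place of \<open>j\<close>.\<close>
        have "p \<noteq> v3" using b p_at v_j by auto
        from geodesic_setD[OF geodesic pu(1) v(3) this]
        obtain l where l: "p l \<noteq> v3 l" "p(l := v3 l) \<in> S" by blast
        have "l \<noteq> j" using l nz zp v_j by auto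
        moreover have "l \<noteq> i" using l p_at v_i by auto
        ultimately have "l = k" using l(1) off[of l] v3 by (metis fun_upd_other)
        with l have pk: "x(i := y i, k := v3 k) \<in> S" by (simp add: p_def)
        have "u \<noteq> v3" using a u_at v_i by auto
        from geodesic_setD[OF geodesic pu(2) v(3) this]
        obtain l' where l': "u l' \<noteq> v3 l'" "u(l' := v3 l') \<in> S" by blast
        have "l' \<noteq> i" using l' nz zu v_i by auto
        moreover have "l' \<noteq> j" using l' u_at v_j by auto
        ultimately have "l' = k" using l'(1) off[of l'] v3 by (metis fun_upd_other)
        with l' have uk: "x(j := y j, k := v3 k) \<in> S" by (simp add: u_def)
        have zk: "x(i := y i, j := y j, k := v3 k) \<in> S" using v(3) v3 by (simp add: z_def)
        from six_cycle[OF im jm km ij ki[symmetric] kj[symmetric] a[symmetric] b[symmetric] xk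
            x xi xj pk uk zk] nz
        show False by (simp add: z_def)
      qed
    qed
  qed
  then show "x(i := y i, j := y j) \<in> S" by (simp add: z_def)
qed

end

theorem proposition5:
  fixes m :: nat and U :: "nat \<Rightarrow> 'a set"
    and G :: "'v pair_pre_digraph" and \<phi> :: "'v \<Rightarrow> nat \<Rightarrow> 'a"
  assumes "\<And>i. i \<in> {1..m} \<Longrightarrow> finite (U i)"
    and "\<And>i. i \<in> {1..m} \<Longrightarrow> U i \<noteq> {}"
    and "quasi_median_graph G"
    and "isometric_embedding \<phi> G (hamming_graph m U)"
  shows "ample m U (\<phi> ` pverts G)"
proof -
  interpret quasi_median_in_hamming m U G \<phi> by unfold_locales (use assms in auto)
  interpret pair_graph G by (rule graph)
  have "ample m U S"
    using S_subset assms(2) geodesic clique square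
    by (intro ample_if_geodesic_clique_square) (simp_all add: S_def pair_finite_verts)
  then show ?thesis by (simp add: S_def)
qed

end
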